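(* Let $\Phi=\{\phi_1,\ldots,\phi_r\}$ be a family of nonzero graph signals, and assume that $|\gamma_l(m)|<1$ for all $1\le m\le M$ and $1\le l\le d$. For $1\le m\le M$ let $\mathbf{C}(m)=\big[\langle\widehat{\phi}_i(m),\widehat{\phi}_j(m)\rangle\big]_{1\le i,j\le r}\in\mathbb{R}^{r\times r}$. Then the frame operator $$S\mathbf{x}=\sum_{\phi\in\Phi}\sum_{\boldsymbol{\alpha}\in\mathbb{Z}_+^d}\langle\mathbf{x},\mathbf{S}^{\boldsymbol{\alpha}}\phi\rangle\,\mathbf{S}^{\boldsymbol{\alpha}}\phi,\quad\mathbf{x}\in\mathcal{S}(\Phi),$$ is shift-invariant if and only if $$\mathbf{C}(m)\mathbf{C}(m')=\mathbf{0}\quad\text{for all}\ 1\le m\ne m'\le M.$$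
   Context: Let $\mathcal{G}=(V,E,\mathbf{W})$ be a finite, simple, undirected graph with $N\ge 2$ vertices. A graph signal is a vector in $\mathbb{R}^V$; $\langle\cdot,\cdot\rangle$ is the standard inner product on $\mathbb{R}^V$. A graph shift is a matrix $\mathbf{S}=[s(i,j)]_{i,j\in V}$ with $s(i,j)=0$ unless $i=j$ or $(i,j)\in E$. Standing assumption: $\mathbf{S}_1,\ldots,\mathbf{S}_d$ are graph shifts that are real-valued, symmetric and pairwise commuting. Choose an orthogonal matrix $\mathbf{U}=[\mathbf{u}_1,\ldots,\mathbf{u}_N]$ with $\mathbf{S}_l=\sum_{n=1}^N\lambda_l(n)\mathbf{u}_n\mathbf{u}_n^T$ for $1\le l\le d$, and set $\boldsymbol{\lambda}(n)=[\lambda_1(n),\ldots,\lambda_d(n)]^T\in\mathbb{R}^d$. Let $\boldsymbol{\gamma}(m)=[\gamma_1(m),\ldots,\gamma_d(m)]^T$, $1\le m\le M$, be the distinct elements of $\{\boldsymbol{\lambda}(n): 1\le n\le N\}$. Put $\mathbf{P}_m=\sum_{\boldsymbol{\lambda}(n)=\boldsymbol{\gamma}(m)}\mathbf{u}_n\mathbf{u}_n^T$ (independent of the choice of $\mathbf{U}$) and $\widehat{\mathbf{x}}(m)=\mathbf{P}_m\mathbf{x}$ for $\mathbf{x}\in\mathbb{R}^V$. For $\boldsymbol{\alpha}=(\alpha_1,\ldots,\alpha_d)\in\mathbb{Z}_+^d$ (nonnegative integers) write $\mathbf{S}^{\boldsymbol{\alpha}}=\mathbf{S}_1^{\alpha_1}\cdots\mathbf{S}_d^{\alpha_d}$.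 For a family $\Phi$ of graph signals, $\mathcal{S}(\Phi)=\mathrm{span}\{\mathbf{S}^{\boldsymbol{\alpha}}\phi : \boldsymbol{\alpha}\in\mathbb{Z}_+^d,\ \phi\in\Phi\}$. A linear operator $S$ on $\mathcal{S}(\Phi)$ is shift-invariant if $S\,\mathbf{S}_l\mathbf{x}=\mathbf{S}_l\,S\mathbf{x}$ for all $\mathbf{x}\in\mathcal{S}(\Phi)$ and $1\le l\le d$. *)

theory Defs
  imports "HOL-Analysis.Analysis"
begin

text \<open>
  Graph signals are vectors in \<open>real ^ 'v\<close>, where the finite type \<open>'v\<close> is the vertex set, and
  shifts are matrices \<open>real ^ 'v ^ 'v\<close>. The shifts \<open>S l\<close> are indexed by a finite linearly ordered
  type \<open>'d\<close>; the order only fixes the order of the factors in \<open>shift_monomial\<close>.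
\<close>

definition simple_undirected_graph :: "('v \<times> 'v) set \<Rightarrow> bool" where
  "simple_undirected_graph E \<longleftrightarrow> sym E \<and> irrefl E"

definition graph_shift :: "('v \<times> 'v) set \<Rightarrow> real ^ 'v ^ 'v \<Rightarrow> bool" where
  "graph_shift E A \<longleftrightarrow> (\<forall>i j. i \<noteq> j \<and> (i, j) \<notin> E \<longrightarrow> A $ i $ j = 0)"

definition outer_product :: "real ^ 'v \<Rightarrow> real ^ 'v \<Rightarrow> real ^ 'v ^ 'v" where
  "outer_product u w = (\<chi> i j. u $ i * w $ j)"

text \<open>The type class power on \<open>real ^ 'v ^ 'v\<close> would be the entrywise one.\<close>

primrec matrix_power :: "real ^ 'v ^ 'v \<Rightarrow> nat \<Rightarrow> real ^ 'v ^ 'v" where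
  "matrix_power A 0 = mat 1"
| "matrix_power A (Suc k) = A ** matrix_power A k"

definition shift_monomial ::
  "('d::{finite,linorder} \<Rightarrow> real ^ 'v ^ 'v) \<Rightarrow> ('d \<Rightarrow> nat) \<Rightarrow> real ^ 'v ^ 'v" where
  "shift_monomial S \<alpha> =
    foldr (**) (map (\<lambda>l. matrix_power (S l) (\<alpha> l)) (sorted_list_of_set UNIV)) (mat 1)"

definition shift_space ::
  "('d::{finite,linorder} \<Rightarrow> real ^ 'v ^ 'v) \<Rightarrow> ('r \<Rightarrow> real ^ 'v) \<Rightarrow> (real ^ 'v) set" where
  "shift_space S \<phi> = span {shift_monomial S \<alpha> *v \<phi> i |\<alpha> i. True}"

definition shift_invariant_on ::
  "('d \<Rightarrow> real ^ 'v ^ 'v) \<Rightarrow> (real ^ 'v) set \<Rightarrow> (real ^ 'v \<Rightarrow> real ^ 'v) \<Rightarrow> bool" where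
  "shift_invariant_on S X T \<longleftrightarrow> (\<forall>x\<in>X. \<forall>l. T (S l *v x) = S l *v T x)"

text \<open>
  If every joint eigenvalue of the shifts has all its components in the open interval from
  \<open>-1\<close> to \<open>1\<close>, the terms of the inner series are dominated by a convergent multiple geometric
  series, so the series converges absolutely and \<open>infsum\<close> is its actual sum.
\<close>

definition frame_operator ::
  "('d::{finite,linorder} \<Rightarrow> real ^ 'v ^ 'v) \<Rightarrow> ('r::finite \<Rightarrow> real ^ 'v) \<Rightarrow> real ^ 'v \<Rightarrow> real ^ 'v"
  where
  "frame_operator S \<phi> x =
    (\<Sum>i\<in>UNIV. \<Sum>\<^sub>\<infinity>\<alpha>. (x \<bullet> (shift_monomial S \<alpha> *v \<phi> i)) *\<^sub>R (shift_monomial S \<alpha> *v \<phi> i))"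

text \<open>
  \<open>U\<close> has the joint eigenvectors as columns and \<open>lam n\<close> is the vector of eigenvalues of the
  shifts belonging to \<open>column n U\<close>. The columns of the square matrix \<open>U\<close> are enumerated by
  \<open>'v\<close> itself.
\<close>

definition joint_diagonalization ::
  "('d::finite \<Rightarrow> real ^ 'v ^ 'v) \<Rightarrow> real ^ 'v ^ 'v \<Rightarrow> ('v \<Rightarrow> real ^ 'd) \<Rightarrow> bool" where
  "joint_diagonalization S U lam \<longleftrightarrow>
    orthogonal_matrix U \<and>
    (\<forall>l. S l = (\<Sum>n\<in>UNIV. (lam n $ l) *\<^sub>R outer_product (column n U) (column n U)))"

definition spectral_projection ::
  "real ^ 'v ^ 'v \<Rightarrow> ('v \<Rightarrow> real ^ 'd) \<Rightarrow> real ^ 'd \<Rightarrow> real ^ 'v ^ 'v" where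
  "spectral_projection U lam g =
    (\<Sum>n | lam n = g. outer_product (column n U) (column n U))"

definition fourier_gram ::
  "real ^ 'v ^ 'v \<Rightarrow> ('v \<Rightarrow> real ^ 'd) \<Rightarrow> ('r \<Rightarrow> real ^ 'v) \<Rightarrow> real ^ 'd \<Rightarrow> real ^ 'r ^ 'r" where
  "fourier_gram U lam \<phi> g =
    (\<chi> i j. (spectral_projection U lam g *v \<phi> i) \<bullet> (spectral_projection U lam g *v \<phi> j))"

end

theory Submission
  imports Defs
begin

text \<open>
  Summing the multiple geometric series over the exponents turns the frame operator into a finite
  sum over pairs \<open>g\<close>, \<open>h\<close> of joint eigenvalues, with \<open>P\<^sub>g\<close> the projection onto the joint
  eigenspace of \<open>g\<close>:
  \<open>T x = (\<Sum>i, g, h. K g h \<langle>x, P\<^sub>g \<phi>\<^sub>i\<rangle> P\<^sub>h \<phi>\<^sub>i)\<close>, where \<open>K g h = (\<Prod>l. 1 / (1 - g\<^sub>l h\<^sub>l))\<close> never vanishes.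
  The shift-invariant space is spanned by the vectors \<open>P\<^sub>g \<phi>\<^sub>j\<close>, so \<open>T\<close> commutes with the shifts
  iff \<open>P\<^sub>h (T (P\<^sub>g \<phi>\<^sub>j)) = 0\<close> for all \<open>g \<noteq> h\<close> and all \<open>j\<close>, that is, iff
  \<open>(\<Sum>i. C(g)\<^sub>j\<^sub>i P\<^sub>h \<phi>\<^sub>i) = 0\<close>. The inner products of this vector with the \<open>P\<^sub>h \<phi>\<^sub>k\<close>, in
  whose span it lies, are the entries of \<open>C(g) C(h)\<close>.
\<close>

section \<open>A multiple geometric series\<close>

lemma has_sum_finite_sum:
  fixes f :: "'i \<Rightarrow> 'a \<Rightarrow> 'b::topological_comm_monoid_add"
  assumes "finite I" and "\<And>i. i \<in> I \<Longrightarrow> (f i has_sum s i) A"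
  shows "((\<lambda>x. \<Sum>i\<in>I. f i x) has_sum (\<Sum>i\<in>I. s i)) A"
  using assms by (induction I rule: finite_induct) (auto intro: has_sum_add)

text \<open>Closed form of the sum of \<open>g^\<alpha> h^\<alpha>\<close> over all multi-indices
  when the coordinates are below 1 in modulus: the reproducing kernel of the Hardy space on the
  polydisc, at real points.\<close>

definition multi_geometric :: "real ^ 'd \<Rightarrow> real ^ 'd::finite \<Rightarrow> real" where
  "multi_geometric g h = (\<Prod>l\<in>UNIV. 1 / (1 - g $ l * h $ l))"

lemma multi_geometric_nonzero:
  assumes "\<And>l. \<bar>g $ l\<bar> < 1" and "\<And>l. \<bar>h $ l\<bar> < 1"
  shows "multi_geometric g h \<noteq> 0"
proof -
  have "1 - g $ l * h $ l \<noteq> 0" for l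
    using abs_mult_less[OF assms(1)[of l] assms(2)[of l]] by (auto simp: abs_mult[symmetric])
  then show ?thesis
    by (simp add: multi_geometric_def)
qed

lemma has_sum_multi_geometric:
  assumes g: "\<And>l. \<bar>g $ l\<bar> < 1" and h: "\<And>l. \<bar>h $ l\<bar> < 1"
  shows "((\<lambda>\<alpha>. (\<Prod>l\<in>UNIV. (g $ l) ^ \<alpha> l) * (\<Prod>l\<in>UNIV. (h $ l) ^ \<alpha> l))
    has_sum multi_geometric g h) UNIV"
proof -
  define f where "f = (\<lambda>l k. (g $ l * h $ l) ^ k)"
  have less: "\<bar>g $ l * h $ l\<bar> < 1" for l
    using abs_mult_less[OF g[of l] h[of l]] by (simp add: abs_mult)
  have summable: "summable (\<lambda>k. norm (f l k))" for l
    using less[of l] by (simp add: f_def power_abs summable_geometric)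
  have one: "(f l has_sum (1 / (1 - g $ l * h $ l))) UNIV" for l
    using norm_summable_imp_has_sum[OF summable[of l]] geometric_sums[of "g $ l * h $ l"] less[of l]
    by (simp add: f_def)
  have "(\<lambda>k. norm (f l k)) summable_on UNIV" for l
    using summable[of l] by (simp add: norm_summable_imp_summable_on)
  \<comment> \<open>\<open>PiE UNIV (\<lambda>_. UNIV)\<close> consists of all exponents, so
    multiplying out the one-variable series gives the sum over multi-indices.\<close>
  then have "infsum (\<lambda>\<alpha>. \<Prod>l\<in>UNIV. f l (\<alpha> l)) (PiE UNIV (\<lambda>_. UNIV)) =
      (\<Prod>l\<in>UNIV. infsum (f l) UNIV)"
    by (intro infsum_prod_PiE_abs) auto
  also have "\<dots> = multi_geometric g h"
    unfolding multi_geometric_def by (intro prod.cong refl infsumI one)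
  finally have val: "infsum (\<lambda>\<alpha>. \<Prod>l\<in>UNIV. f l (\<alpha> l)) UNIV = multi_geometric g h"
    by (simp add: PiE_UNIV_domain)
  \<comment> \<open>\<open>infsum\<close> of a non-summable family is \<open>0\<close>, so a nonzero value already gives summability\<close>
  then have "(\<lambda>\<alpha>. \<Prod>l\<in>UNIV. f l (\<alpha> l)) summable_on UNIV"
    using multi_geometric_nonzero[OF g h] infsum_not_exists by fastforce
  then show ?thesis
    using val by (simp add: has_sum_iff f_def power_mult_distrib prod.distrib)
qed

section \<open>Joint spectral decomposition\<close>

lemma matrix_sum_vector:
  fixes A :: "'i \<Rightarrow> real ^ 'n ^ 'm"
  assumes "finite I"
  shows "(\<Sum>i\<in>I. A i) *v x = (\<Sum>i\<in>I. A i *v x)"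
  using assms by (induction I rule: finite_induct) (auto simp: matrix_vector_mult_add_rdistrib)

lemma matrix_vector_sum:
  fixes A :: "real ^ 'n ^ 'm"
  shows "A *v (\<Sum>i\<in>I. x i) = (\<Sum>i\<in>I. A *v x i)"
  by (rule linear_sum[OF matrix_vector_mul_linear, unfolded o_def])

lemma outer_product_vector: "outer_product u w *v x = (w \<bullet> x) *\<^sub>R u"
  by (simp add: vec_eq_iff outer_product_def matrix_vector_mult_def inner_vec_def
      sum_distrib_left sum_distrib_right mult_ac)

locale jointly_diagonalized =
  fixes S :: "'d::{finite,linorder} \<Rightarrow> real ^ 'v ^ 'v"
    and U :: "real ^ 'v ^ 'v"
    and lam :: "'v \<Rightarrow> real ^ 'd::{finite,linorder}"
  assumes diag: "joint_diagonalization S U lam"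
begin

abbreviation P :: "real ^ 'd::{finite,linorder} \<Rightarrow> real ^ 'v \<Rightarrow> real ^ 'v" where
  "P g x \<equiv> spectral_projection U lam g *v x"

text \<open>The eigenvalue of the monomial with exponent \<open>\<alpha>\<close> on the joint
  eigenspace of \<open>g\<close>; it turns sums of exponents into products.\<close>

abbreviation character :: "real ^ 'd::{finite,linorder} \<Rightarrow> ('d \<Rightarrow> nat) \<Rightarrow> real" where
  "character g \<alpha> \<equiv> (\<Prod>l\<in>UNIV. (g $ l) ^ \<alpha> l)"

lemma column_inner: "column n U \<bullet> column k U = (if n = k then 1 else 0)"
proof (cases "n = k")
  case True
  then show ?thesis
    using diag by (auto simp: joint_diagonalization_def orthogonal_matrix_orthonormal_columns
        norm_eq_1)
next
  case False
  then show ?thesis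
    using diag by (auto simp: joint_diagonalization_def orthogonal_matrix_orthonormal_columns
        orthogonal_def)
qed

lemma P_expand: "P g x = (\<Sum>n | lam n = g. (column n U \<bullet> x) *\<^sub>R column n U)"
  by (simp add: spectral_projection_def matrix_sum_vector outer_product_vector)

lemma S_expand: "S l *v x = (\<Sum>n\<in>UNIV. (lam n $ l * (column n U \<bullet> x)) *\<^sub>R column n U)"
proof -
  have "S l = (\<Sum>n\<in>UNIV. (lam n $ l) *\<^sub>R outer_product (column n U) (column n U))"
    using diag by (simp add: joint_diagonalization_def)
  then show ?thesis
    by (simp add: matrix_sum_vector scaleR_matrix_vector_assoc[symmetric] outer_product_vector)
qed

lemma P_column: "P g (column n U) = (if lam n = g then column n U else 0)"
  by (simp add: P_expand column_inner if_distrib[of "\<lambda>c. c *\<^sub>R _"] cong: if_cong)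

lemma S_column: "S l *v column n U = (lam n $ l) *\<^sub>R column n U"
  by (simp add: S_expand column_inner if_distrib[of "\<lambda>c. c *\<^sub>R _"] if_distrib[of "\<lambda>c. _ * c"]
      cong: if_cong)

lemma column_expand: "x = (\<Sum>n\<in>UNIV. (column n U \<bullet> x) *\<^sub>R column n U)"
proof -
  have component: "(transpose U *v x) $ n = column n U \<bullet> x" for n
    by (simp add: matrix_vector_mult_def inner_vec_def column_def transpose_def
        del: transpose_matrix_vector)
  have "U *v (transpose U *v x) = (U ** transpose U) *v x"
    by (rule matrix_vector_mul_assoc)
  then have "U *v (transpose U *v x) = x"
    using diag by (simp add: joint_diagonalization_def orthogonal_matrix_def del: transpose_matrix_vector)
  then show ?thesis
    by (simp only: matrix_mult_sum[of U] scalar_mult_eq_scaleR component)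
qed

text \<open>The fibres of \<open>lam\<close> partition the columns, so this is the orthonormal
  expansion grouped by joint eigenvalue.\<close>

lemma sum_P: "(\<Sum>g\<in>range lam. P g x) = x"
  using sum.image_gen[of UNIV "\<lambda>n. (column n U \<bullet> x) *\<^sub>R column n U" lam] column_expand[of x]
  by (simp add: P_expand)

lemma P_P: "P g (P h x) = (if g = h then P g x else 0)"
  by (auto simp: P_expand[of h] matrix_vector_sum matrix_vector_mult_scaleR P_column P_expand[of g]
      intro!: sum.cong)

lemma P_symmetric: "P g x \<bullet> y = x \<bullet> P g y"
  by (simp add: P_expand inner_sum_left inner_sum_right inner_commute mult_ac)

lemma P_inner_P_distinct: "g \<noteq> h \<Longrightarrow> P g x \<bullet> P h y = 0"
  by (simp add: P_symmetric P_P)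

section \<open>Action of the shifts on the joint eigenspaces\<close>

lemma S_P: "S l *v P g x = (g $ l) *\<^sub>R P g x"
  by (auto simp: P_expand matrix_vector_sum matrix_vector_mult_scaleR S_column scaleR_sum_right
      intro!: sum.cong)

lemma S_spectral: "S l *v x = (\<Sum>g\<in>range lam. (g $ l) *\<^sub>R P g x)"
  by (subst sum_P[of x, symmetric]) (simp only: matrix_vector_sum S_P)

text \<open>Orthogonality of the eigenspaces isolates one summand. The vector may vary with
  \<open>h\<close>; both the shifts and the frame operator have this form.\<close>

lemma P_sum_scaleR_P:
  assumes "g \<in> range lam"
  shows "P g (\<Sum>h\<in>range lam. c h *\<^sub>R P h (x h)) = c g *\<^sub>R P g (x g)"
proof -
  have "P g (\<Sum>h\<in>range lam. c h *\<^sub>R P h (x h)) =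
      (\<Sum>h\<in>range lam. if h = g then c g *\<^sub>R P g (x g) else 0)"
    unfolding matrix_vector_sum
    by (intro sum.cong) (auto simp: matrix_vector_mult_scaleR P_P)
  then show ?thesis
    using assms by simp
qed

lemma P_S:
  assumes "g \<in> range lam"
  shows "P g (S l *v x) = (g $ l) *\<^sub>R P g x"
  using P_sum_scaleR_P[OF assms, of "\<lambda>h. h $ l" "\<lambda>_. x"] by (simp add: S_spectral)

section \<open>Monomials in the shifts\<close>

lemma matrix_power_P: "matrix_power (S l) k *v P g x = (g $ l) ^ k *\<^sub>R P g x"
  by (induction k)
    (simp_all add: matrix_vector_mul_assoc[symmetric] matrix_vector_mult_scaleR S_P)

lemma shift_monomial_P: "shift_monomial S \<alpha> *v P g x = character g \<alpha> *\<^sub>R P g x"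
proof -
  \<comment> \<open>The induction needs an arbitrary list of factors; only afterwards is it the
    sorted list of all indices.\<close>
  have "foldr (**) (map (\<lambda>l. matrix_power (S l) (\<alpha> l)) ls) (mat 1) *v P g x =
      prod_list (map (\<lambda>l. (g $ l) ^ \<alpha> l) ls) *\<^sub>R P g x" for ls
    by (induction ls)
      (simp_all add: matrix_vector_mul_assoc[symmetric] matrix_vector_mult_scaleR matrix_power_P)
  then show ?thesis
    by (simp add: shift_monomial_def prod.distinct_set_conv_list[symmetric])
qed

lemma shift_monomial_spectral:
  "shift_monomial S \<alpha> *v x = (\<Sum>g\<in>range lam. character g \<alpha> *\<^sub>R P g x)"
  by (subst sum_P[of x, symmetric]) (simp only: matrix_vector_sum shift_monomial_P)

text \<open>Comparing eigenvalues on each eigenspace avoids moving the new factor past the others in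
  the ordered product.\<close>

lemma S_shift_monomial:
  "S l *v (shift_monomial S \<alpha> *v x) = shift_monomial S (\<alpha>(l := Suc (\<alpha> l))) *v x"
proof -
  have "character g (\<alpha>(l := Suc (\<alpha> l))) = g $ l * character g \<alpha>" for g
  proof -
    have "(\<Prod>k\<in>UNIV - {l}. (g $ k) ^ (\<alpha>(l := Suc (\<alpha> l))) k) = (\<Prod>k\<in>UNIV - {l}. (g $ k) ^ \<alpha> k)"
      by (intro prod.cong) auto
    then show ?thesis
      by (simp add: prod.remove[of UNIV l])
  qed
  then show ?thesis
    by (simp add: shift_monomial_spectral matrix_vector_sum matrix_vector_mult_scaleR S_P mult_ac)
qed

section \<open>The shift-invariant space of a family\<close>

text \<open>Each step applies a factor \<open>S l - h $ l\<close> to remove the component at one further joint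
  eigenvalue \<open>h\<close>, choosing \<open>l\<close> such that \<open>h $ l \<noteq> g $ l\<close>.\<close>

lemma P_mem_invariant_subspace:
  assumes X: "subspace X" and inv: "\<And>l x. x \<in> X \<Longrightarrow> S l *v x \<in> X"
    and g: "g \<in> range lam" and x: "x \<in> X"
  shows "P g x \<in> X"
proof -
  have "\<exists>y\<in>X. P g y = P g x \<and> (\<forall>h\<in>F. P h y = 0)" if "F \<subseteq> range lam - {g}" for F
  proof -
    have "finite F"
      using that by (rule finite_subset) simp
    then show ?thesis
      using that
    proof (induction F rule: finite_induct)
      case empty
      then show ?case using x by auto
    next
      case (insert h F)
      then obtain y where y: "y \<in> X" "P g y = P g x" "\<And>k. k \<in> F \<Longrightarrow> P k y = 0"
        by auto
      have "g \<noteq> h"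
        using insert.prems by auto
      then obtain l where l: "g $ l \<noteq> h $ l"
        by (auto simp: vec_eq_iff)
      \<comment> \<open>The operator multiplies the component at \<open>k\<close> by a number that
        is 1 for \<open>k = g\<close> and 0 for \<open>k = h\<close>; components already zero stay
        zero.\<close>
      define z where "z = (1 / (g $ l - h $ l)) *\<^sub>R (S l *v y - (h $ l) *\<^sub>R y)"
      have z: "P k z = ((k $ l - h $ l) / (g $ l - h $ l)) *\<^sub>R P k y" if "k \<in> range lam" for k
        using that by (simp add: z_def matrix_vector_mult_scaleR matrix_vector_mult_diff_distrib P_S
            scaleR_left_diff_distrib[symmetric])
      have "z \<in> X"
        unfolding z_def using X y(1) inv by (intro subspace_scale subspace_diff) auto
      moreover have "P g z = P g x"
        using z[OF g] l y(2) by simp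
      moreover have "P k z = 0" if "k \<in> insert h F" for k
        using that z[of k] insert.prems y(3) by auto
      ultimately show ?case by blast
    qed
  qed
  \<comment> \<open>With \<open>F\<close> all of \<open>range lam - {g}\<close>, the component at
    \<open>g\<close> is the only one left, so \<open>y\<close> is \<open>P g x\<close>
    itself.\<close>
  from this[OF order_refl] obtain y
    where y: "y \<in> X" "P g y = P g x" "\<And>h. h \<in> range lam - {g} \<Longrightarrow> P h y = 0"
    by metis
  have "y = (\<Sum>h\<in>range lam. P h y)"
    by (rule sum_P[symmetric])
  also have "\<dots> = P g y + (\<Sum>h\<in>range lam - {g}. P h y)"
    by (rule sum.remove[OF _ g]) simp
  also have "\<dots> = P g x"
    by (simp add: y)
  finally show ?thesis
    using y(1) by simp
qed

lemma S_mem_shift_space: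
  assumes "x \<in> shift_space S \<phi>"
  shows "S l *v x \<in> shift_space S \<phi>"
  using assms unfolding shift_space_def
proof (induction rule: span_induct_alt)
  case base
  then show ?case by (simp add: span_zero)
next
  case (step c x y)
  then obtain \<alpha> i where "x = shift_monomial S \<alpha> *v \<phi> i"
    by blast
  then have "S l *v x = shift_monomial S (\<alpha>(l := Suc (\<alpha> l))) *v \<phi> i"
    by (simp only: S_shift_monomial)
  then have "S l *v x \<in> span {shift_monomial S \<alpha> *v \<phi> i |\<alpha> i. True}"
    by (intro span_base) blast
  then show ?case
    using step by (simp add: matrix_vector_right_distrib matrix_vector_mult_scaleR span_add span_scale)
qed

text \<open>Monomials act as combinations of the projections; conversely, an invariant subspace
  contains the spectral components of its members. The new generators are joint eigenvectors or
  zero.\<close>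

lemma shift_space_eq:
  "shift_space S \<phi> = span {P g (\<phi> i) |g i. g \<in> range lam}"
proof
  have "shift_monomial S \<alpha> *v \<phi> i \<in> span {P g (\<phi> i) |g i. g \<in> range lam}" for \<alpha> i
    unfolding shift_monomial_spectral by (intro span_sum span_scale span_base) auto
  then show "shift_space S \<phi> \<subseteq> span {P g (\<phi> i) |g i. g \<in> range lam}"
    unfolding shift_space_def by (intro span_minimal) auto
next
  \<comment> \<open>The zero exponent gives \<open>\<phi> i\<close> itself.\<close>
  have "shift_monomial S (\<lambda>_. 0) *v \<phi> i \<in> shift_space S \<phi>" for i
    unfolding shift_space_def by (intro span_base) auto
  then have "\<phi> i \<in> shift_space S \<phi>" for i
    by (simp add: shift_monomial_spectral sum_P)
  then have "P g (\<phi> i) \<in> shift_space S \<phi>" if "g \<in> range lam" for g i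
    using that S_mem_shift_space
    by (intro P_mem_invariant_subspace) (auto simp: shift_space_def)
  then show "span {P g (\<phi> i) |g i. g \<in> range lam} \<subseteq> shift_space S \<phi>"
    by (intro span_minimal) (auto simp: shift_space_def)
qed

section \<open>The frame operator\<close>

text \<open>Row \<open>j\<close> of the product holds the inner products of the \<open>j\<close>-th
  sum with the vectors \<open>P h (\<phi> k)\<close>. That sum is a combination of the same vectors,
  so if the row vanishes it is orthogonal to itself.\<close>

lemma fourier_gram_mult_eq_0_iff:
  "fourier_gram U lam \<phi> g ** fourier_gram U lam \<phi> h = 0 \<longleftrightarrow>
    (\<forall>j. (\<Sum>i\<in>UNIV. (P g (\<phi> j) \<bullet> P g (\<phi> i)) *\<^sub>R P h (\<phi> i)) = 0)"
proof -
  define v where "v j = (\<Sum>i\<in>UNIV. (P g (\<phi> j) \<bullet> P g (\<phi> i)) *\<^sub>R P h (\<phi> i))" for j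
  have entry: "(fourier_gram U lam \<phi> g ** fourier_gram U lam \<phi> h) $ j $ k = v j \<bullet> P h (\<phi> k)" for j k
    by (simp add: v_def matrix_matrix_mult_def fourier_gram_def inner_sum_left)
  have "v j = 0" if "\<And>k. v j \<bullet> P h (\<phi> k) = 0" for j
  proof -
    have "v j \<bullet> v j = (\<Sum>i\<in>UNIV. (P g (\<phi> j) \<bullet> P g (\<phi> i)) * (v j \<bullet> P h (\<phi> i)))"
      by (subst (2) v_def) (simp add: inner_sum_right)
    then show ?thesis
      using that by simp
  qed
  then have "(\<forall>j. v j = 0) \<longleftrightarrow> (\<forall>j k. v j \<bullet> P h (\<phi> k) = 0)"
    by auto
  also have "\<dots> \<longleftrightarrow> fourier_gram U lam \<phi> g ** fourier_gram U lam \<phi> h = 0"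
    unfolding entry[symmetric] by (simp add: vec_eq_iff)
  finally show ?thesis
    unfolding v_def by simp
qed

context
  fixes \<phi> :: "'r::finite \<Rightarrow> real ^ 'v"
  assumes lam_bound: "\<And>n l. \<bar>lam n $ l\<bar> < 1"
begin

text \<open>Both occurrences of the monomial are expanded over the eigenspaces;
  \<open>\<alpha>\<close> then enters only through a product of two characters, which sums to the
  kernel.\<close>

lemma frame_operator_spectral:
  "frame_operator S \<phi> x =
    (\<Sum>i\<in>UNIV. \<Sum>g\<in>range lam. \<Sum>h\<in>range lam.
      (multi_geometric g h * (x \<bullet> P g (\<phi> i))) *\<^sub>R P h (\<phi> i))"
proof -
  have "((\<lambda>\<alpha>. (x \<bullet> (shift_monomial S \<alpha> *v w)) *\<^sub>R (shift_monomial S \<alpha> *v w)) has_sum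
      (\<Sum>g\<in>range lam. \<Sum>h\<in>range lam. (multi_geometric g h * (x \<bullet> P g w)) *\<^sub>R P h w)) UNIV" for w
  proof -
    have "((\<lambda>\<alpha>. ((character g \<alpha> * character h \<alpha>) * (x \<bullet> P g w)) *\<^sub>R P h w) has_sum
        (multi_geometric g h * (x \<bullet> P g w)) *\<^sub>R P h w) UNIV"
      if "g \<in> range lam" "h \<in> range lam" for g h
    proof -
      have "((\<lambda>\<alpha>. character g \<alpha> * character h \<alpha>) has_sum multi_geometric g h) UNIV"
        using that lam_bound by (intro has_sum_multi_geometric) auto
      then have "((\<lambda>\<alpha>. (character g \<alpha> * character h \<alpha>) *\<^sub>R ((x \<bullet> P g w) *\<^sub>R P h w)) has_sum
          multi_geometric g h *\<^sub>R ((x \<bullet> P g w) *\<^sub>R P h w)) UNIV"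
        by (rule has_sum_bounded_linear[OF bounded_linear_scaleR_left])
      then show ?thesis
        by simp
    qed
    then have "((\<lambda>\<alpha>. \<Sum>g\<in>range lam. \<Sum>h\<in>range lam.
          ((character g \<alpha> * character h \<alpha>) * (x \<bullet> P g w)) *\<^sub>R P h w) has_sum
        (\<Sum>g\<in>range lam. \<Sum>h\<in>range lam. (multi_geometric g h * (x \<bullet> P g w)) *\<^sub>R P h w)) UNIV"
      by (intro has_sum_finite_sum) auto
    moreover have "(x \<bullet> (shift_monomial S \<alpha> *v w)) *\<^sub>R (shift_monomial S \<alpha> *v w) =
        (\<Sum>g\<in>range lam. \<Sum>h\<in>range lam.
          ((character g \<alpha> * character h \<alpha>) * (x \<bullet> P g w)) *\<^sub>R P h w)" for \<alpha>
      unfolding shift_monomial_spectral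
      by (simp add: inner_sum_right scaleR_sum_left scaleR_sum_right sum_distrib_left
          sum_distrib_right mult_ac)
        (subst sum.swap, simp add: mult_ac)
    ultimately show ?thesis
      by simp
  qed
  then show ?thesis
    unfolding frame_operator_def by (intro sum.cong refl infsumI)
qed

lemma linear_frame_operator: "linear (frame_operator S \<phi>)"
  by (rule linearI)
    (simp_all add: frame_operator_spectral inner_add_left distrib_left scaleR_add_left sum.distrib
      scaleR_sum_right mult.left_commute)

text \<open>By orthogonality the argument meets only the components at \<open>g\<close>, and the
  outer projection keeps only those at \<open>h\<close>, so one term of the double sum survives for
  each \<open>i\<close>.\<close>

lemma P_frame_operator_P:
  assumes g: "g \<in> range lam" and h: "h \<in> range lam"
  shows "P h (frame_operator S \<phi> (P g x)) =
    multi_geometric g h *\<^sub>R (\<Sum>i\<in>UNIV. (P g x \<bullet> P g (\<phi> i)) *\<^sub>R P h (\<phi> i))"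
proof -
  have "P h (\<Sum>k\<in>range lam. \<Sum>k'\<in>range lam.
        (multi_geometric k k' * (P g x \<bullet> P k y)) *\<^sub>R P k' y) =
      (multi_geometric g h * (P g x \<bullet> P g y)) *\<^sub>R P h y" for y
  proof -
    have "P h (\<Sum>k\<in>range lam. \<Sum>k'\<in>range lam.
          (multi_geometric k k' * (P g x \<bullet> P k y)) *\<^sub>R P k' y) =
        (\<Sum>k\<in>range lam. (multi_geometric k h * (P g x \<bullet> P k y)) *\<^sub>R P h y)"
      using h by (subst matrix_vector_sum) (simp add: P_sum_scaleR_P)
    also have "\<dots> = (\<Sum>k\<in>range lam. if k = g then (multi_geometric g h * (P g x \<bullet> P g y)) *\<^sub>R P h y else 0)"
      by (intro sum.cong refl) (auto simp: P_inner_P_distinct)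
    finally show ?thesis
      using g by simp
  qed
  then show ?thesis
    unfolding frame_operator_spectral
    by (subst matrix_vector_sum) (simp add: scaleR_sum_right)
qed

section \<open>Criterion for shift-invariance\<close>

lemma shift_invariant_iff_offdiagonal:
  "shift_invariant_on S (shift_space S \<phi>) (frame_operator S \<phi>) \<longleftrightarrow>
    (\<forall>g\<in>range lam. \<forall>h\<in>range lam. g \<noteq> h \<longrightarrow>
      (\<forall>j. P h (frame_operator S \<phi> (P g (\<phi> j))) = 0))"
    (is "?inv \<longleftrightarrow> ?offdiag")
proof
  let ?T = "frame_operator S \<phi>"
  assume ?inv
  show ?offdiag
  proof (intro ballI impI allI)
    fix g h j assume g: "g \<in> range lam" and h: "h \<in> range lam" and "g \<noteq> h"
    then obtain l where l: "g $ l \<noteq> h $ l"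
      by (auto simp: vec_eq_iff)
    have "P g (\<phi> j) \<in> shift_space S \<phi>"
      unfolding shift_space_eq using g by (intro span_base) auto
    then have "?T (S l *v P g (\<phi> j)) = S l *v ?T (P g (\<phi> j))"
      using \<open>?inv\<close> by (simp add: shift_invariant_on_def)
    then have "(g $ l) *\<^sub>R ?T (P g (\<phi> j)) = S l *v ?T (P g (\<phi> j))"
      by (simp add: S_P linear_scale[OF linear_frame_operator])
    \<comment> \<open>The same component is scaled by \<open>g $ l\<close> on the left and by
      \<open>h $ l\<close> on the right; these differ, so it is zero.\<close>
    then have "P h ((g $ l) *\<^sub>R ?T (P g (\<phi> j))) = P h (S l *v ?T (P g (\<phi> j)))"
      by simp
    then show "P h (?T (P g (\<phi> j))) = 0"
      using l by (simp add: P_S[OF h] matrix_vector_mult_scaleR)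
  qed
next
  let ?T = "frame_operator S \<phi>"
  assume offdiag: ?offdiag
  have base: "?T (S l *v P g (\<phi> j)) = S l *v ?T (P g (\<phi> j))" if g: "g \<in> range lam" for g j l
  proof -
    \<comment> \<open>Without components off \<open>g\<close>, the image stays in the joint
      eigenspace of \<open>g\<close>, where \<open>S l\<close> is a scalar.\<close>
    have "(\<Sum>h\<in>range lam - {g}. P h (?T (P g (\<phi> j)))) = 0"
      using offdiag g by (intro sum.neutral ballI) (metis Diff_iff insertCI)
    then have "?T (P g (\<phi> j)) = P g (?T (P g (\<phi> j)))"
      using sum_P[of "?T (P g (\<phi> j))"] sum.remove[OF _ g, of "\<lambda>h. P h (?T (P g (\<phi> j)))"] by simp
    then have "S l *v ?T (P g (\<phi> j)) = (g $ l) *\<^sub>R ?T (P g (\<phi> j))"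
      by (metis S_P)
    then show ?thesis
      by (simp add: S_P linear_scale[OF linear_frame_operator])
  qed
  show ?inv
    unfolding shift_invariant_on_def
  proof (intro ballI allI)
    fix x l assume "x \<in> shift_space S \<phi>"
    \<comment> \<open>Both sides are linear in \<open>x\<close>, so agreement on the spanning
      vectors suffices.\<close>
    moreover have "linear (\<lambda>x. ?T (S l *v x))" "linear (\<lambda>x. S l *v ?T x)"
      using linear_compose[OF matrix_vector_mul_linear linear_frame_operator]
        linear_compose[OF linear_frame_operator matrix_vector_mul_linear]
      by (simp_all add: o_def)
    ultimately show "?T (S l *v x) = S l *v ?T x"
      unfolding shift_space_eq using base by (elim linear_eq_on[rotated 2]) auto
  qed
qed

text \<open>Each off-diagonal component is a Gram sum times a nonzero kernel value, which
  cancels.\<close>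

lemma shift_invariant_iff_fourier_gram:
  "shift_invariant_on S (shift_space S \<phi>) (frame_operator S \<phi>) \<longleftrightarrow>
    (\<forall>g\<in>range lam. \<forall>h\<in>range lam. g \<noteq> h \<longrightarrow>
      fourier_gram U lam \<phi> g ** fourier_gram U lam \<phi> h = 0)"
proof -
  have "multi_geometric g h \<noteq> 0" if "g \<in> range lam" "h \<in> range lam" for g h
    using that lam_bound by (intro multi_geometric_nonzero) auto
  then show ?thesis
    unfolding shift_invariant_iff_offdiagonal fourier_gram_mult_eq_0_iff
    by (simp add: P_frame_operator_P)
qed

end

end

theorem theorem4p6:
  fixes E :: "('v::finite \<times> 'v) set"
    and S :: "'d::{finite,linorder} \<Rightarrow> real ^ 'v ^ 'v"
    and U :: "real ^ 'v ^ 'v"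
    and lam :: "'v \<Rightarrow> real ^ 'd::{finite,linorder}"
    and \<gamma> :: "nat \<Rightarrow> real ^ 'd::{finite,linorder}"
    and M :: nat
    and \<phi> :: "'r::finite \<Rightarrow> real ^ 'v"
  assumes "CARD('v) \<ge> 2"
    and "simple_undirected_graph E"
    and "\<And>l. graph_shift E (S l)"
    and "\<And>l. transpose (S l) = S l"
    and "\<And>l k. S l ** S k = S k ** S l"
    and "joint_diagonalization S U lam"
    and "bij_betw \<gamma> {1..M} (range lam)"
    and "\<And>i. \<phi> i \<noteq> 0"
    and "\<And>m l. m \<in> {1..M} \<Longrightarrow> \<bar>\<gamma> m $ l\<bar> < 1"
  shows "shift_invariant_on S (shift_space S \<phi>) (frame_operator S \<phi>) \<longleftrightarrow>
    (\<forall>m\<in>{1..M}. \<forall>m'\<in>{1..M}. m \<noteq> m' \<longrightarrow>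
      fourier_gram U lam \<phi> (\<gamma> m) ** fourier_gram U lam \<phi> (\<gamma> m') = 0)"
proof -
  interpret jointly_diagonalized S U lam
    using \<open>joint_diagonalization S U lam\<close> by unfold_locales
  \<comment> \<open>Injectivity of \<open>\<gamma>\<close> turns distinct indices into distinct
    joint eigenvalues.\<close>
  have range: "range lam = \<gamma> ` {1..M}" and inj: "inj_on \<gamma> {1..M}"
    using \<open>bij_betw \<gamma> {1..M} (range lam)\<close> by (auto simp: bij_betw_def)
  have "\<bar>lam n $ l\<bar> < 1" for n l
    using assms(9) range by (metis imageE rangeI)
  from shift_invariant_iff_fourier_gram[OF this]
  show ?thesis
    unfolding range using inj by (simp add: inj_on_eq_iff)
qed

end
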